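(* For every integer $n\geq0$, \[ CP_{(2,2)}(n)=\frac{1}{(q;q)_{2n}}\sum_{r= -\infty}^\infty (-1)^r q^{3r^2} {2n\brack n-3r}_{q}. \]
   Context: $(a;q)_m=\prod_{j=0}^{m-1}(1-aq^j)$; for integers $a,b$, ${a\brack b}_q=\frac{(q;q)_a}{(q;q)_b(q;q)_{a-b}}$ if $0\le b\le a$ and $0$ otherwise. A cylindric partition with profile $(c_1,c_2)$ is a pair of partitions $(\lambda^{(1)},\lambda^{(2)})$ (parts weakly decreasing, $\lambda^{(i)}_j=0$ beyond the number of parts) with $\lambda^{(1)}_j\ge\lambda^{(2)}_{j+c_2}$ and $\lambda^{(2)}_j\ge\lambda^{(1)}_{j+c_1}$ for all $j\ge1$; its size is $|\lambda^{(1)}|+|\lambda^{(2)}|$. $CP_{(2,2)}(n)$ is the generating function $\sum q^{\text{size}}$ over cylindric partitions of profile $(2,2)$ in which each partition has at most $n$ parts, with $CP_{(2,2)}(0)=1$. *)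

theory Defs
  imports
    "HOL-Computational_Algebra.Formal_Power_Series"
    "HOL-Library.Groups_Big_Fun"
begin

definition qpoch :: "'a::comm_ring_1 \<Rightarrow> 'a \<Rightarrow> nat \<Rightarrow> 'a" where
  "qpoch a q m = (\<Prod>j<m. 1 - a * q ^ j)"

text \<open>The indeterminate \<open>q\<close> is \<^term>\<open>fps_X\<close>. Both factors of the denominator have constant
  coefficient 1, so the quotient is the usual one by a unit.\<close>

definition qbinom :: "int \<Rightarrow> int \<Rightarrow> rat fps" where
  "qbinom a b =
     (if 0 \<le> b \<and> b \<le> a
      then qpoch fps_X fps_X (nat a) /
           (qpoch fps_X fps_X (nat b) * qpoch fps_X fps_X (nat (a - b)))
      else 0)"

text \<open>A partition is the list of its (positive) parts in weakly decreasing order, so its number of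
  parts is the length of the list and its size is the sum of the list.\<close>

definition is_partition :: "nat list \<Rightarrow> bool" where
  "is_partition xs \<longleftrightarrow> sorted_wrt (\<ge>) xs \<and> (\<forall>x\<in>set xs. 0 < x)"

text \<open>Parts are numbered from 1 and vanish beyond the number of parts.\<close>

definition part :: "nat list \<Rightarrow> nat \<Rightarrow> nat" where
  "part xs j = (if 1 \<le> j \<and> j \<le> length xs then xs ! (j - 1) else 0)"

definition cylindric_partition :: "nat \<times> nat \<Rightarrow> nat list \<times> nat list \<Rightarrow> bool" where
  "cylindric_partition = (\<lambda>(c1, c2) (l1, l2).
     is_partition l1 \<and> is_partition l2 \<and>
     (\<forall>j\<ge>1. part l1 j \<ge> part l2 (j + c2)) \<and>
     (\<forall>j\<ge>1. part l2 j \<ge> part l1 (j + c1)))"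

definition cylindric_partitions :: "nat \<times> nat \<Rightarrow> nat \<Rightarrow> nat \<Rightarrow> (nat list \<times> nat list) set" where
  "cylindric_partitions c n m =
     {(l1, l2). cylindric_partition c (l1, l2) \<and> length l1 \<le> n \<and> length l2 \<le> n \<and>
        sum_list l1 + sum_list l2 = m}"

definition CP :: "nat \<times> nat \<Rightarrow> nat \<Rightarrow> rat fps" where
  "CP c n = Abs_fps (\<lambda>m. of_nat (card (cylindric_partitions c n m)))"

text \<open>The cardinality in \<^const>\<open>CP\<close> is a genuine count.\<close>

lemma finite_cylindric_partitions: "finite (cylindric_partitions c n m)"
proof (rule finite_subset)
  let ?L = "{xs. set xs \<subseteq> {..m} \<and> length xs \<le> n}"
  show "cylindric_partitions c n m \<subseteq> ?L \<times> ?L"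
    by (auto simp: cylindric_partitions_def dest!: member_le_sum_list)
  show "finite (?L \<times> ?L)"
    by (intro finite_cartesian_product finite_lists_length_le) auto
qed

lemma CP_0: "CP c 0 = 1"
proof -
  have "cylindric_partitions c 0 m = (if m = 0 then {([], [])} else {})" for m
    by (cases c)
       (auto simp: cylindric_partitions_def cylindric_partition_def is_partition_def part_def)
  then show ?thesis
    by (simp add: CP_def fps_eq_iff)
qed

text \<open>The bilateral sum over \<open>r\<close> is written with \<^const>\<open>Sum_any\<close>, the sum of a family over a whole
  type, which is meaningful because only finitely many of its terms are nonzero.\<close>

lemma finite_support_qbinom:
  fixes f :: "int \<Rightarrow> rat fps"
  shows "finite {r::int. f r * qbinom (2 * int n) (int n - 3 * r) \<noteq> 0}"
proof (rule finite_subset)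
  show "{r. f r * qbinom (2 * int n) (int n - 3 * r) \<noteq> 0} \<subseteq> {- int n..int n}"
    by (auto simp: qbinom_def split: if_splits)
qed simp

end

theory Submission
  imports Defs
begin

text \<open>Let \<open>F(a, b)\<close> count the cylindric partitions with at most \<open>a\<close> and \<open>b\<close> parts. Subtracting 1
  from every part of a pair with exactly \<open>a\<close> and \<open>b\<close> parts gives, by inclusion-exclusion,
  \<open>F(a,b) - F(a-1,b) - F(a,b-1) + F(a-1,b-1) = q\<^bsup>a+b\<^esup> F(a,b)\<close> for \<open>\<bar>a - b\<bar> \<le> 2\<close>, and the interlacing
  conditions bound the difference of the numbers of parts, so \<open>F(a,a+3) = F(a,a+2)\<close> and symmetrically.
  The same relations hold for
  \<open>H(a,b) = \<Sum>\<^sub>r (-1)\<^sup>r q\<^bsup>3r\<^sup>2\<^esup> / ((q;q)\<^bsub>a-3r\<^esub> (q;q)\<^bsub>b+3r\<^esub>)\<close>: each term satisfies the recurrence, and in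
  \<open>H(a,a+3) - H(a,a+2)\<close> the terms of \<open>r\<close> and \<open>-1-r\<close> cancel. The relations determine the values in the
  strip \<open>\<bar>a - b\<bar> \<le> 2\<close> by induction on \<open>a + b\<close>, and the theorem is the case \<open>a = b = n\<close>.\<close>

section \<open>Cylindric partitions with bounded numbers of parts\<close>

definition raise_parts :: "nat \<Rightarrow> nat list \<Rightarrow> nat list" where
  "raise_parts k xs = map Suc xs @ replicate (k - length xs) 1"

text \<open>Parts equal to 1 become zeros, which a list of positive parts cannot store; the filter
  drops them.\<close>

definition lower_parts :: "nat list \<Rightarrow> nat list" where
  "lower_parts xs = filter (\<lambda>x. 0 < x) (map (\<lambda>x. x - 1) xs)"

lemma length_raise_parts: "length xs \<le> k \<Longrightarrow> length (raise_parts k xs) = k"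
  by (simp add: raise_parts_def)

lemma length_lower_parts: "length (lower_parts xs) \<le> length xs"
  unfolding lower_parts_def by (metis length_filter_le length_map)

lemma sum_list_raise_parts:
  assumes "length xs \<le> k"
  shows "sum_list (raise_parts k xs) = sum_list xs + k"
proof -
  have "sum_list (map Suc xs) = sum_list xs + length xs"
    by (induction xs) auto
  then show ?thesis
    using assms by (simp add: raise_parts_def sum_list_replicate)
qed

lemma is_partition_raise_parts: "is_partition xs \<Longrightarrow> is_partition (raise_parts k xs)"
  by (auto simp: is_partition_def raise_parts_def sorted_wrt_append sorted_wrt_map
      intro: sorted_wrt_iff_nth_less[THEN iffD2])

lemma is_partition_lower_parts:
  assumes "is_partition xs"
  shows "is_partition (lower_parts xs)"
proof -
  have "sorted_wrt (\<ge>) (map (\<lambda>x. x - 1) xs)"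
    using assms
    by (auto simp: is_partition_def sorted_wrt_map intro: sorted_wrt_mono_rel[rotated])
  then show ?thesis
    by (auto simp: is_partition_def lower_parts_def intro: sorted_wrt_filter)
qed

lemma lower_raise_parts:
  assumes "is_partition xs"
  shows "lower_parts (raise_parts k xs) = xs"
proof -
  have "filter ((<) 0) xs = xs"
    using assms by (auto simp: is_partition_def filter_id_conv)
  then show ?thesis
    by (simp add: raise_parts_def lower_parts_def comp_def)
qed

text \<open>Induction from the largest part: once the head is 1, all later parts are 1, so lowering
  erases everything and the padding alone restores it.\<close>

lemma raise_lower_parts:
  "is_partition xs \<Longrightarrow> raise_parts (length xs) (lower_parts xs) = xs"
proof (induction xs)
  case Nil
  then show ?case
    by (simp add: raise_parts_def lower_parts_def)
next
  case (Cons x xs)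
  have xs: "is_partition xs" and x: "0 < x" "\<forall>y\<in>set xs. y \<le> x \<and> 0 < y"
    using Cons.prems by (auto simp: is_partition_def)
  show ?case
  proof (cases "x = 1")
    case True
    then have "\<forall>y\<in>set xs. y = 1"
      using x by force
    then have "xs = replicate (length xs) 1"
      by (simp add: replicate_eqI)
    moreover have "lower_parts (replicate m 1) = []" for m
      by (simp add: lower_parts_def)
    ultimately have "lower_parts xs = []"
      by metis
    moreover have "lower_parts (x # xs) = lower_parts xs"
      using True by (simp add: lower_parts_def)
    ultimately show ?thesis
      using True \<open>xs = replicate (length xs) 1\<close> by (simp add: raise_parts_def)
  next
    case False
    then have "lower_parts (x # xs) = (x - 1) # lower_parts xs"
      using x by (simp add: lower_parts_def)
    then show ?thesis
      using Cons.IH[OF xs] x by (simp add: raise_parts_def)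
  qed
qed

lemma part_raise_parts:
  assumes "length xs \<le> k"
  shows "part (raise_parts k xs) j = (if 1 \<le> j \<and> j \<le> k then Suc (part xs j) else 0)"
  using assms by (auto simp: part_def raise_parts_def nth_append)

lemma part_lower_parts:
  assumes "is_partition xs"
  shows "part (lower_parts xs) j = part xs j - 1"
proof -
  have "part xs j = (if 1 \<le> j \<and> j \<le> length xs then Suc (part (lower_parts xs) j) else 0)"
    using part_raise_parts[OF length_lower_parts[of xs], of j]
    unfolding raise_lower_parts[OF assms] .
  moreover have "part (lower_parts xs) j = 0" if "\<not> (1 \<le> j \<and> j \<le> length xs)"
    using that length_lower_parts[of xs] by (auto simp: part_def)
  ultimately show ?thesis
    by auto
qed

lemma part_eq_0_iff:
  assumes "is_partition xs" and "1 \<le> j"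
  shows "part xs j = 0 \<longleftrightarrow> length xs < j"
proof -
  have "xs ! (j - 1) \<in> set xs" if "j \<le> length xs"
    using assms that by (intro nth_mem) auto
  then show ?thesis
    using assms by (auto simp: part_def is_partition_def)
qed

section \<open>The interlacing conditions under raising and lowering\<close>

lemma cylindric_partition_length:
  assumes "cylindric_partition (c1, c2) (l1, l2)"
  shows "length l2 \<le> length l1 + c2" and "length l1 \<le> length l2 + c1"
proof -
  \<comment> \<open>The first position past the end of one list carries a zero, which forces a zero
    at the shifted position of the other.\<close>
  have p: "is_partition l1" "is_partition l2"
    and "part l2 (Suc (length l1) + c2) \<le> part l1 (Suc (length l1))"
    and "part l1 (Suc (length l2) + c1) \<le> part l2 (Suc (length l2))"
    using assms by (auto simp: cylindric_partition_def)
  then have "part l2 (Suc (length l1) + c2) = 0" "part l1 (Suc (length l2) + c1) = 0"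
    by (auto simp: part_def split: if_splits)
  then show "length l2 \<le> length l1 + c2" "length l1 \<le> length l2 + c1"
    using p by (simp_all add: part_eq_0_iff)
qed

text \<open>If the right side of an interlacing inequality gains 1, so does the left:
  \<open>j + c2 \<le> b\<close> and \<open>b \<le> a + c2\<close> give \<open>j \<le> a\<close>, and
  likewise with the roles exchanged.\<close>

lemma cylindric_partition_raise_parts:
  assumes "cylindric_partition (c1, c2) (l1, l2)"
    and "length l1 \<le> a" "length l2 \<le> b" "a \<le> b + c1" "b \<le> a + c2"
  shows "cylindric_partition (c1, c2) (raise_parts a l1, raise_parts b l2)"
  using assms by (auto simp: cylindric_partition_def part_raise_parts is_partition_raise_parts)

lemma cylindric_partition_lower_parts:
  assumes "cylindric_partition (c1, c2) (l1, l2)"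
  shows "cylindric_partition (c1, c2) (lower_parts l1, lower_parts l2)"
  using assms
  by (auto simp: cylindric_partition_def part_lower_parts is_partition_lower_parts diff_le_mono)

text \<open>The bounds are integers, so that the inclusion-exclusion below needs no case distinction when
  a bound becomes negative.\<close>

definition bounded_cps :: "nat \<times> nat \<Rightarrow> int \<Rightarrow> int \<Rightarrow> nat \<Rightarrow> (nat list \<times> nat list) set" where
  "bounded_cps c a b m =
     {(l1, l2). cylindric_partition c (l1, l2) \<and> int (length l1) \<le> a \<and> int (length l2) \<le> b \<and>
        sum_list l1 + sum_list l2 = m}"

definition exact_cps :: "nat \<times> nat \<Rightarrow> int \<Rightarrow> int \<Rightarrow> nat \<Rightarrow> (nat list \<times> nat list) set" where
  "exact_cps c a b m =
     {(l1, l2). cylindric_partition c (l1, l2) \<and> int (length l1) = a \<and> int (length l2) = b \<and>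
        sum_list l1 + sum_list l2 = m}"

definition bounded_cp_gf :: "nat \<times> nat \<Rightarrow> int \<Rightarrow> int \<Rightarrow> rat fps" where
  "bounded_cp_gf c a b = Abs_fps (\<lambda>m. of_nat (card (bounded_cps c a b m)))"

lemma CP_eq_bounded_cp_gf: "CP c n = bounded_cp_gf c (int n) (int n)"
  by (simp add: CP_def bounded_cp_gf_def bounded_cps_def cylindric_partitions_def)

lemma finite_bounded_cps: "finite (bounded_cps c a b m)"
proof (rule finite_subset)
  show "bounded_cps c a b m \<subseteq> cylindric_partitions c (nat (max a b)) m"
    by (auto simp: bounded_cps_def cylindric_partitions_def)
qed (rule finite_cylindric_partitions)

section \<open>Relations for the generating functions\<close>

lemma card_exact_cps:
  assumes "0 \<le> a" "0 \<le> b" "a \<le> b + int c1" "b \<le> a + int c2"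
  shows "card (exact_cps (c1, c2) a b m) =
    (if m < nat (a + b) then 0 else card (bounded_cps (c1, c2) a b (m - nat (a + b))))"
proof -
  define k l where "k = nat a" and "l = nat b"
  have ab: "a = int k" "b = int l"
    using assms by (simp_all add: k_def l_def)
  have c: "k \<le> l + c1" "l \<le> k + c2"
    using assms ab by auto
  let ?raise = "\<lambda>(l1, l2). (raise_parts k l1, raise_parts l l2)"
  let ?lower = "\<lambda>(l1, l2). (lower_parts l1, lower_parts l2)"
  have part: "is_partition l1" "is_partition l2"
    if "cylindric_partition (c1, c2) (l1, l2)" for l1 l2
    using that by (auto simp: cylindric_partition_def)
  have sum: "sum_list xs = sum_list (lower_parts xs) + length xs" if "is_partition xs" for xs
    using sum_list_raise_parts[OF length_lower_parts[of xs]] raise_lower_parts[OF that] by simp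
  show ?thesis
  proof (cases "m < k + l")
    case True
    \<comment> \<open>Each of the \<open>k + l\<close> parts is at least 1, so no such pair has size
      below \<open>k + l\<close>.\<close>
    have "False" if "(l1, l2) \<in> exact_cps (c1, c2) a b m" for l1 l2
    proof -
      have "cylindric_partition (c1, c2) (l1, l2)"
        using that by (simp add: exact_cps_def)
      note sum[OF part(1)[OF this]] sum[OF part(2)[OF this]]
      then show False
        using that True by (simp add: exact_cps_def ab)
    qed
    then have "exact_cps (c1, c2) a b m = {}"
      by auto
    then show ?thesis
      using True by (simp add: ab nat_int_add)
  next
    case False
    have "bij_betw ?raise (bounded_cps (c1, c2) a b (m - (k + l))) (exact_cps (c1, c2) a b m)"
    proof (rule bij_betw_byWitness[where f' = ?lower])
      show "\<forall>x\<in>bounded_cps (c1, c2) a b (m - (k + l)). ?lower (?raise x) = x"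
        by (auto simp: bounded_cps_def dest: part intro: lower_raise_parts)
      show "\<forall>x\<in>exact_cps (c1, c2) a b m. ?raise (?lower x) = x"
        by (auto simp: exact_cps_def ab dest: part intro: raise_lower_parts)
      show "?raise ` bounded_cps (c1, c2) a b (m - (k + l)) \<subseteq> exact_cps (c1, c2) a b m"
        using False c
        by (auto simp: bounded_cps_def exact_cps_def ab length_raise_parts sum_list_raise_parts
            intro: cylindric_partition_raise_parts)
      show "?lower ` exact_cps (c1, c2) a b m \<subseteq> bounded_cps (c1, c2) a b (m - (k + l))"
      proof clarify
        fix l1 l2
        assume "(l1, l2) \<in> exact_cps (c1, c2) a b m"
        then have cp: "cylindric_partition (c1, c2) (l1, l2)"
          and len: "length l1 = k" "length l2 = l" and m: "sum_list l1 + sum_list l2 = m"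
          by (auto simp: exact_cps_def ab)
        show "(lower_parts l1, lower_parts l2) \<in> bounded_cps (c1, c2) a b (m - (k + l))"
          using cylindric_partition_lower_parts[OF cp] length_lower_parts[of l1]
            length_lower_parts[of l2] sum[OF part(1)[OF cp]] sum[OF part(2)[OF cp]] len m
          by (auto simp: bounded_cps_def ab)
      qed
    qed
    then show ?thesis
      using False by (simp add: ab nat_int_add bij_betw_same_card)
  qed
qed

text \<open>A pair that meets neither of the two tightened bounds attains both lengths exactly. All
  terms are added because the counts are natural numbers.\<close>

lemma card_bounded_cps:
  "card (bounded_cps c a b m) + card (bounded_cps c (a - 1) (b - 1) m) =
   card (bounded_cps c (a - 1) b m) + card (bounded_cps c a (b - 1) m) + card (exact_cps c a b m)"
proof -
  let ?A = "bounded_cps c (a - 1) b m" and ?B = "bounded_cps c a (b - 1) m"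
    and ?E = "exact_cps c a b m"
  have U: "bounded_cps c a b m = (?A \<union> ?B) \<union> ?E" and I: "?A \<inter> ?B = bounded_cps c (a - 1) (b - 1) m"
    and D: "(?A \<union> ?B) \<inter> ?E = {}"
    by (auto simp: bounded_cps_def exact_cps_def)
  have "finite ?E"
    using U finite_bounded_cps[of c a b m] by (metis finite_Un)
  then have "card (bounded_cps c a b m) = card (?A \<union> ?B) + card ?E"
    unfolding U using D by (intro card_Un_disjoint) (auto simp: finite_bounded_cps)
  moreover have "card ?A + card ?B = card (?A \<union> ?B) + card (bounded_cps c (a - 1) (b - 1) m)"
    unfolding I[symmetric] by (intro card_Un_Int finite_bounded_cps)
  ultimately show ?thesis
    by simp
qed

lemma bounded_cp_gf_rec:
  assumes "0 \<le> a" "0 \<le> b" "a \<le> b + int c1" "b \<le> a + int c2"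
  shows "bounded_cp_gf (c1, c2) a b - bounded_cp_gf (c1, c2) (a - 1) b -
      bounded_cp_gf (c1, c2) a (b - 1) + bounded_cp_gf (c1, c2) (a - 1) (b - 1) =
    fps_X ^ nat (a + b) * bounded_cp_gf (c1, c2) a b"
proof (rule fps_ext)
  fix m
  let ?c = "(c1, c2)"
  have "of_nat (card (bounded_cps ?c a b m)) - of_nat (card (bounded_cps ?c (a - 1) b m)) -
      of_nat (card (bounded_cps ?c a (b - 1) m)) + of_nat (card (bounded_cps ?c (a - 1) (b - 1) m)) =
      (of_nat (card (exact_cps ?c a b m)) :: rat)"
    using arg_cong[OF card_bounded_cps[of ?c a b m], of "of_nat :: nat \<Rightarrow> rat"]
    by (simp add: algebra_simps)
  then show "fps_nth (bounded_cp_gf ?c a b - bounded_cp_gf ?c (a - 1) b - bounded_cp_gf ?c a (b - 1) +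
      bounded_cp_gf ?c (a - 1) (b - 1)) m =
      fps_nth (fps_X ^ nat (a + b) * bounded_cp_gf ?c a b) m"
    by (simp add: bounded_cp_gf_def fps_X_power_mult_nth card_exact_cps[OF assms])
qed

lemma bounded_cp_gf_boundary:
  shows "bounded_cp_gf (c1, c2) a (a + int c2 + 1) = bounded_cp_gf (c1, c2) a (a + int c2)"
    and "bounded_cp_gf (c1, c2) (b + int c1 + 1) b = bounded_cp_gf (c1, c2) (b + int c1) b"
proof -
  have "bounded_cps (c1, c2) a (a + int c2 + 1) m = bounded_cps (c1, c2) a (a + int c2) m"
    "bounded_cps (c1, c2) (b + int c1 + 1) b m = bounded_cps (c1, c2) (b + int c1) b m" for m
    by (auto simp: bounded_cps_def dest: cylindric_partition_length)
  then show "bounded_cp_gf (c1, c2) a (a + int c2 + 1) = bounded_cp_gf (c1, c2) a (a + int c2)"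
    "bounded_cp_gf (c1, c2) (b + int c1 + 1) b = bounded_cp_gf (c1, c2) (b + int c1) b"
    by (simp_all add: bounded_cp_gf_def)
qed

lemma bounded_cp_gf_neg: "a < 0 \<or> b < 0 \<Longrightarrow> bounded_cp_gf c a b = 0"
proof -
  assume "a < 0 \<or> b < 0"
  then have "bounded_cps c a b m = {}" for m
    by (auto simp: bounded_cps_def)
  then show ?thesis
    by (simp add: bounded_cp_gf_def fps_eq_iff)
qed

section \<open>The alternating sum\<close>

text \<open>The reciprocal of \<open>(q;q)_k\<close>, extended by 0 to negative \<open>k\<close>. At
  \<open>k \<le> 0\<close> the factor \<open>1 - fps_X ^ nat k\<close> is 0, so the step from
  \<open>k\<close> to \<open>k - 1\<close> is uniform in all integers.\<close>

definition inv_qfact :: "int \<Rightarrow> rat fps" where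
  "inv_qfact k = (if k < 0 then 0 else inverse (qpoch fps_X fps_X (nat k)))"

lemma qpoch_fps_X_nth_0: "fps_nth (qpoch fps_X fps_X m) 0 = (1 :: rat)"
  by (induction m) (simp_all add: qpoch_def)

lemma inv_qfact_diff_one: "inv_qfact (k - 1) = (1 - fps_X ^ nat k) * inv_qfact k"
proof (cases "k \<le> 0")
  case True
  then show ?thesis
    by (auto simp: inv_qfact_def)
next
  case False
  define m where "m = nat (k - 1)"
  have k: "k = int (Suc m)"
    using False by (simp add: m_def)
  let ?Q = "qpoch fps_X fps_X m :: rat fps" and ?u = "1 - fps_X ^ Suc m :: rat fps"
  have "qpoch fps_X fps_X (Suc m) = ?Q * ?u"
    by (simp add: qpoch_def)
  moreover have "?u * inverse ?u = 1"
    by (intro inverse_mult_eq_1') simp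
  ultimately have "?u * inverse (qpoch fps_X fps_X (Suc m)) = inverse ?Q"
    by (simp add: fps_inverse_mult mult.left_commute)
  then show ?thesis
    unfolding k by (simp add: inv_qfact_def nat_add_distrib)
qed

definition alt_term :: "int \<Rightarrow> int \<Rightarrow> int \<Rightarrow> rat fps" where
  "alt_term a b r =
     (-1) ^ nat \<bar>r\<bar> * fps_X ^ nat (3 * r\<^sup>2) * (inv_qfact (a - 3 * r) * inv_qfact (b + 3 * r))"

definition alt_sum :: "int \<Rightarrow> int \<Rightarrow> rat fps" where
  "alt_sum a b = Sum_any (alt_term a b)"

lemma alt_term_eq_0: "a < 3 * r \<or> b < - (3 * r) \<Longrightarrow> alt_term a b r = 0"
  by (auto simp: alt_term_def inv_qfact_def)

lemma finite_support_alt_term: "finite {r. alt_term a b r \<noteq> 0}"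
proof (rule finite_subset)
  have "\<not> (a < 3 * r \<or> b < - (3 * r))" if "alt_term a b r \<noteq> 0" for r
    using that alt_term_eq_0 by blast
  then show "{r. alt_term a b r \<noteq> 0} \<subseteq> {- \<bar>b\<bar>..\<bar>a\<bar>}"
    by force
qed simp

text \<open>With \<open>x = a - 3r\<close> and \<open>y = b + 3r\<close> this is the identity
  \<open>1 + (1 - q^x)(1 - q^y) - q^(x+y) = (1 - q^x) + (1 - q^y)\<close>.\<close>

lemma alt_term_rec:
  assumes "0 \<le> a + b"
  shows "alt_term a b r + alt_term (a - 1) (b - 1) r - fps_X ^ nat (a + b) * alt_term a b r =
    alt_term (a - 1) b r + alt_term a (b - 1) r"
proof -
  let ?x = "a - 3 * r" and ?y = "b + 3 * r"
  let ?s = "(-1) ^ nat \<bar>r\<bar> * fps_X ^ nat (3 * r\<^sup>2) :: rat fps"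
  have *: "inv_qfact (a - 1 - 3 * r) = (1 - fps_X ^ nat ?x) * inv_qfact ?x"
    "inv_qfact (b - 1 + 3 * r) = (1 - fps_X ^ nat ?y) * inv_qfact ?y"
    using inv_qfact_diff_one[of ?x] inv_qfact_diff_one[of ?y] by (simp_all add: algebra_simps)
  \<comment> \<open>Exponents add only when no \<open>nat\<close> truncates; otherwise one
    reciprocal factor is 0.\<close>
  have "fps_X ^ nat (a + b) * (inv_qfact ?x * inv_qfact ?y) =
      fps_X ^ nat ?x * fps_X ^ nat ?y * (inv_qfact ?x * inv_qfact ?y)"
  proof (cases "0 \<le> ?x \<and> 0 \<le> ?y")
    case True
    then have "nat (a + b) = nat ?x + nat ?y"
      by (simp add: nat_add_distrib[symmetric])
    then show ?thesis
      by (simp only: power_add)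
  qed (auto simp: inv_qfact_def)
  then have **: "fps_X ^ nat (a + b) * (?s * (inv_qfact ?x * inv_qfact ?y)) =
      ?s * (fps_X ^ nat ?x * fps_X ^ nat ?y * (inv_qfact ?x * inv_qfact ?y))"
    by (subst mult.left_commute) (rule arg_cong)
  show ?thesis
    unfolding alt_term_def * ** by (simp add: algebra_simps)
qed

lemma finite_support_add:
  fixes f g :: "'a \<Rightarrow> 'b::monoid_add"
  assumes "finite {x. f x \<noteq> 0}" "finite {x. g x \<noteq> 0}"
  shows "finite {x. f x + g x \<noteq> 0}"
  by (rule finite_subset[OF _ finite_UnI[OF assms]]) auto

section \<open>Recurrence, symmetry and boundary values of the alternating sum\<close>

lemma alt_sum_rec:
  assumes "0 \<le> a + b"
  shows "alt_sum a b - alt_sum (a - 1) b - alt_sum a (b - 1) + alt_sum (a - 1) (b - 1) =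
    fps_X ^ nat (a + b) * alt_sum a b"
proof -
  let ?q = "fps_X ^ nat (a + b) :: rat fps"
  have fin: "finite {r. ?q * alt_term a b r \<noteq> 0}"
    by (rule finite_subset[OF _ finite_support_alt_term[of a b]]) auto
  have "alt_sum a b + alt_sum (a - 1) (b - 1) =
      Sum_any (\<lambda>r. alt_term a b r + alt_term (a - 1) (b - 1) r)"
    unfolding alt_sum_def by (intro Sum_any.distrib[symmetric] finite_support_alt_term)
  also have "\<dots> = Sum_any (\<lambda>r. ?q * alt_term a b r + (alt_term (a - 1) b r + alt_term a (b - 1) r))"
    using alt_term_rec[OF assms] by (intro Sum_any.cong) (simp add: algebra_simps)
  also have "\<dots> = Sum_any (\<lambda>r. ?q * alt_term a b r) +
      (Sum_any (alt_term (a - 1) b) + Sum_any (alt_term a (b - 1)))"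
    by (simp add: Sum_any.distrib fin finite_support_alt_term finite_support_add)
  also have "Sum_any (\<lambda>r. ?q * alt_term a b r) = ?q * alt_sum a b"
    unfolding alt_sum_def by (rule Sum_any_right_distrib[symmetric, OF finite_support_alt_term])
  finally show ?thesis
    unfolding alt_sum_def by (simp add: algebra_simps)
qed

lemma alt_sum_commute: "alt_sum a b = alt_sum b a"
  unfolding alt_sum_def
  by (rule Sum_any.reindex_cong[of uminus])
     (auto simp: fun_eq_iff alt_term_def mult_ac intro: o_bij[of uminus])

lemma alt_sum_boundary: "alt_sum a (a + 3) = alt_sum a (a + 2)"
proof -
  define d where "d r = alt_term a (a + 3) r + - alt_term a (a + 2) r" for r
  have d: "d r = (-1) ^ nat \<bar>r\<bar> * fps_X ^ nat (3 * r\<^sup>2) * fps_X ^ nat (a + 3 + 3 * r) *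
      (inv_qfact (a - 3 * r) * inv_qfact (a + 3 + 3 * r))" for r
  proof -
    have *: "inv_qfact (a + 2 + 3 * r) = (1 - fps_X ^ nat (a + 3 + 3 * r)) * inv_qfact (a + 3 + 3 * r)"
      using inv_qfact_diff_one[of "a + 3 + 3 * r"] by (simp add: algebra_simps)
    show ?thesis
      unfolding d_def alt_term_def * by (simp add: algebra_simps)
  qed
  \<comment> \<open>The map \<open>r \<mapsto> - 1 - r\<close> swaps the two reciprocal factors,
    preserves the exponent \<open>3r(r + 1) + a + 3\<close> and changes the parity of
    \<open>r\<close>.\<close>
  have refl: "d (- 1 - r) = - d r" for r
  proof (cases "0 \<le> a - 3 * r \<and> 0 \<le> a + 3 + 3 * r")
    case True
    have "(-1) ^ nat \<bar>- 1 - r\<bar> = - ((-1) ^ nat \<bar>r\<bar> :: rat fps)"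
      by (cases "even r") (auto simp: minus_one_power_iff even_nat_iff)
    moreover have "nat (3 * (- 1 - r)\<^sup>2) + nat (a + 3 + 3 * (- 1 - r)) =
        nat (3 * r\<^sup>2) + nat (a + 3 + 3 * r)"
    proof -
      have nat_eq: "nat x + nat y = nat z + nat w"
        if "x + y = z + w" "0 \<le> x" "0 \<le> y" "0 \<le> z" "0 \<le> w" for x y z w :: int
        using that by arith
      have "3 * (- 1 - r)\<^sup>2 + (a + 3 + 3 * (- 1 - r)) = 3 * r\<^sup>2 + (a + 3 + 3 * r)"
        by (simp add: power2_eq_square algebra_simps)
      moreover have "0 \<le> a + 3 + 3 * (- 1 - r)"
        using True by simp
      ultimately show ?thesis
        using True by (intro nat_eq mult_nonneg_nonneg zero_le_power2) simp_all
    qed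
    then have "fps_X ^ nat (3 * (- 1 - r)\<^sup>2) * fps_X ^ nat (a + 3 + 3 * (- 1 - r)) =
        (fps_X ^ nat (3 * r\<^sup>2) * fps_X ^ nat (a + 3 + 3 * r) :: rat fps)"
      by (simp only: power_add[symmetric])
    ultimately show ?thesis
      unfolding d by (simp add: mult.assoc) (simp add: algebra_simps)
  next
    case False
    then show ?thesis
      by (auto simp: d inv_qfact_def)
  qed
  have fin: "finite {r. d r \<noteq> 0}"
    unfolding d_def
    by (rule finite_support_add) (simp_all add: finite_support_alt_term)
  have "Sum_any d = Sum_any (\<lambda>r. d (- 1 - r))"
    by (rule Sum_any.reindex_cong[of "\<lambda>r. - 1 - r"])
       (auto simp: fun_eq_iff intro: o_bij[of "\<lambda>r. - 1 - r"])
  \<comment> \<open>The sum equals its own negative, hence is 0 over the rationals.\<close>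
  then have "Sum_any d + Sum_any d = Sum_any d + Sum_any (\<lambda>r. d (- 1 - r))"
    by simp
  also have "\<dots> = Sum_any (\<lambda>r. d r + d (- 1 - r))"
    using fin by (intro Sum_any.distrib[symmetric]) (simp_all add: refl)
  also have "\<dots> = 0"
    by (simp add: refl)
  finally have "2 * Sum_any d = 0"
    by simp
  then have "Sum_any d = 0"
    by simp
  moreover have "alt_sum a (a + 3) = Sum_any (\<lambda>r. alt_term a (a + 2) r + d r)"
    unfolding alt_sum_def by (intro Sum_any.cong) (simp add: d_def)
  moreover have "\<dots> = alt_sum a (a + 2) + Sum_any d"
    unfolding alt_sum_def by (intro Sum_any.distrib finite_support_alt_term fin)
  ultimately show ?thesis
    by simp
qed

lemma alt_sum_neg:
  assumes "a < 0 \<or> b < 0" and "\<bar>a - b\<bar> \<le> 3"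
  shows "alt_sum a b = 0"
proof -
  \<comment> \<open>A nonzero term needs \<open>-b \<le> 3r \<le> a\<close>. If
    \<open>a < 0\<close>, then \<open>3r \<le> -3\<close>, so \<open>b \<ge> 3\<close> and
    \<open>b - a \<ge> 4\<close>; the case \<open>b < 0\<close> is symmetric.\<close>
  have "alt_term a b r = 0" for r
    using assms by (intro alt_term_eq_0) presburger
  then show ?thesis
    by (simp add: alt_sum_def)
qed

lemma alt_sum_0_0: "alt_sum 0 0 = 1"
proof -
  have "alt_term 0 0 r = (if r = 0 then 1 else 0)" for r
    using alt_term_eq_0[of 0 r 0] by (auto simp: alt_term_def inv_qfact_def qpoch_def)
  then have "alt_sum 0 0 = Sum_any (\<lambda>r::int. if r = 0 then 1 else 0)"
    unfolding alt_sum_def by (intro Sum_any.cong) simp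
  then show ?thesis
    by simp
qed

section \<open>Comparison in the strip\<close>

lemma bounded_cp_gf_eq_alt_sum:
  assumes "\<bar>a - b\<bar> \<le> 2"
  shows "bounded_cp_gf (2, 2) a b = alt_sum a b"
  using assms
proof (induction "nat (a + b)" arbitrary: a b rule: less_induct)
  case less
  let ?F = "bounded_cp_gf (2, 2)"
  consider "a < 0 \<or> b < 0" | "a = 0" "b = 0" | "0 \<le> a" "0 \<le> b" "0 < a + b"
    by linarith
  then show ?case
  proof cases
    case 1
    then show ?thesis
      using less.prems by (simp add: bounded_cp_gf_neg alt_sum_neg)
  next
    case 2
    then show ?thesis
      using CP_eq_bounded_cp_gf[of "(2, 2)" 0] by (simp add: CP_0 alt_sum_0_0)
  next
    case 3
    have left: "?F (a - 1) b = alt_sum (a - 1) b"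
    \<comment> \<open>Here \<open>(a - 1, b)\<close> lies just outside the strip, at difference 3;
      the boundary relations replace it by \<open>(a - 1, a + 1)\<close>, which is inside and has
      smaller sum.\<close>
    proof (cases "b = a + 2")
      case True
      have "?F (a - 1) (a + 1) = alt_sum (a - 1) (a + 1)"
        using 3 True by (intro less.hyps) auto
      then show ?thesis
        using bounded_cp_gf_boundary(1)[of 2 2 "a - 1"] alt_sum_boundary[of "a - 1"] True
        by (simp add: add.commute)
    next
      case False
      then show ?thesis
        using 3 less.prems by (intro less.hyps) auto
    qed
    have right: "?F a (b - 1) = alt_sum a (b - 1)"
    proof (cases "a = b + 2")
      case True
      have "?F (b + 1) (b - 1) = alt_sum (b + 1) (b - 1)"
        using 3 True by (intro less.hyps) auto
      then show ?thesis
        using bounded_cp_gf_boundary(2)[of 2 2 "b - 1"] alt_sum_boundary[of "b - 1"] True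
        by (simp add: add.commute alt_sum_commute[of _ "b - 1"])
    next
      case False
      then show ?thesis
        using 3 less.prems by (intro less.hyps) auto
    qed
    have diag: "?F (a - 1) (b - 1) = alt_sum (a - 1) (b - 1)"
      using 3 less.prems by (intro less.hyps) auto
    let ?u = "1 - fps_X ^ nat (a + b) :: rat fps"
    have "?u * ?F a b = ?F (a - 1) b + ?F a (b - 1) - ?F (a - 1) (b - 1)"
      using bounded_cp_gf_rec[of a b 2 2] 3 less.prems by (simp add: algebra_simps)
    also have "\<dots> = ?u * alt_sum a b"
      using alt_sum_rec[of a b] 3 unfolding left right diag by (simp add: algebra_simps)
    finally have "?u * ?F a b = ?u * alt_sum a b" .
    \<comment> \<open>Since \<open>a + b > 0\<close>, the constant coefficient is 1 and
      \<open>?u\<close> can be cancelled.\<close>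
    moreover have "fps_nth ?u 0 \<noteq> 0"
      using 3 by simp
    then have "?u \<noteq> 0"
      by (metis fps_zero_nth)
    ultimately show ?thesis
      by simp
  qed
qed

text \<open>The numerator \<open>(q;q)_(2n)\<close> of the q-binomial cancels. For
  \<open>\<bar>k\<bar> > n\<close> the zero conventions of \<open>qbinom\<close> and
  \<open>inv_qfact\<close> agree.\<close>

lemma qbinom_div_qpoch:
  "1 / qpoch fps_X fps_X (2 * n) * qbinom (2 * int n) (int n - k) =
    inv_qfact (int n - k) * inv_qfact (int n + k)"
proof (cases "\<bar>k\<bar> \<le> int n")
  case True
  let ?Q = "\<lambda>m. qpoch fps_X fps_X m :: rat fps"
  have "?Q (2 * n) * inverse (?Q (2 * n)) = 1"
    by (intro inverse_mult_eq_1') (simp add: qpoch_fps_X_nth_0)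
  then show ?thesis
    using True
    by (simp add: qbinom_def inv_qfact_def fps_divide_unit qpoch_fps_X_nth_0 fps_inverse_mult
        nat_mult_distrib mult.assoc[symmetric] mult.commute[of "inverse _" "?Q _"])
next
  case False
  then show ?thesis
    by (auto simp: qbinom_def inv_qfact_def)
qed

theorem theorem5p8:
  fixes n :: nat
  shows "CP (2, 2) n =
    1 / qpoch fps_X fps_X (2 * n) *
      Sum_any (\<lambda>r::int. (-1) ^ nat \<bar>r\<bar> * fps_X ^ nat (3 * r\<^sup>2) *
        qbinom (2 * int n) (int n - 3 * r))"
proof -
  let ?Q = "1 / qpoch fps_X fps_X (2 * n) :: rat fps"
  have "CP (2, 2) n = alt_sum (int n) (int n)"
    by (simp add: CP_eq_bounded_cp_gf bounded_cp_gf_eq_alt_sum)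
  also have "\<dots> = Sum_any (\<lambda>r::int. ?Q * ((-1) ^ nat \<bar>r\<bar> * fps_X ^ nat (3 * r\<^sup>2) *
      qbinom (2 * int n) (int n - 3 * r)))"
    unfolding alt_sum_def alt_term_def qbinom_div_qpoch[symmetric]
    by (intro Sum_any.cong) (simp only: mult_ac)
  also have "\<dots> = ?Q * Sum_any (\<lambda>r::int. (-1) ^ nat \<bar>r\<bar> * fps_X ^ nat (3 * r\<^sup>2) *
      qbinom (2 * int n) (int n - 3 * r))"
    by (rule Sum_any_right_distrib[symmetric, OF finite_support_qbinom])
  finally show ?thesis .
qed

end
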